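(* Every (not necessarily finite) $4$-centralizer group is isoclinic with the quaternion group $Q_8$ of order $8$.
   Context: $\mathrm{Cent}(G)=\{C_G(x): x\in G\}$ is the set of centralizers of elements of $G$; $G$ is $n$-centralizer if $|\mathrm{Cent}(G)|=n$. Two groups $G$ and $H$ are isoclinic if there are isomorphisms $\varphi:G/Z(G)\to H/Z(H)$ and $\phi:G'\to H'$ (where $'$ denotes the commutator subgroup) such that whenever $\varphi(g_iZ(G))=h_iZ(H)$ for $i=1,2$ ($g_i\in G$, $h_i\in H$), one has $\phi([g_1,g_2])=[h_1,h_2]$. *)

theory Defs
  imports "HOL-Algebra.Algebra"
begin

definition centralizer :: "('a, 'b) monoid_scheme \<Rightarrow> 'a \<Rightarrow> 'a set" where
  "centralizer G x = {g \<in> carrier G. g \<otimes>\<^bsub>G\<^esub> x = x \<otimes>\<^bsub>G\<^esub> g}"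

definition Cent :: "('a, 'b) monoid_scheme \<Rightarrow> 'a set set" where
  "Cent G = centralizer G ` carrier G"

(* Finiteness is required separately because card is 0 on infinite sets. *)
definition n_centralizer :: "nat \<Rightarrow> ('a, 'b) monoid_scheme \<Rightarrow> bool" where
  "n_centralizer n G \<longleftrightarrow> finite (Cent G) \<and> card (Cent G) = n"

definition center :: "('a, 'b) monoid_scheme \<Rightarrow> 'a set" where
  "center G = {z \<in> carrier G. \<forall>g \<in> carrier G. z \<otimes>\<^bsub>G\<^esub> g = g \<otimes>\<^bsub>G\<^esub> z}"

(* The convention x y x^-1 y^-1 is the one used in the library's derived. *)
definition commutator :: "('a, 'b) monoid_scheme \<Rightarrow> 'a \<Rightarrow> 'a \<Rightarrow> 'a" where
  "commutator G x y = x \<otimes>\<^bsub>G\<^esub> y \<otimes>\<^bsub>G\<^esub> inv\<^bsub>G\<^esub> x \<otimes>\<^bsub>G\<^esub> inv\<^bsub>G\<^esub> y"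

definition commutator_subgroup :: "('a, 'b) monoid_scheme \<Rightarrow> ('a, 'b) monoid_scheme" where
  "commutator_subgroup G = G\<lparr>carrier := derived G (carrier G)\<rparr>"

definition isoclinic :: "('a, 'c) monoid_scheme \<Rightarrow> ('b, 'd) monoid_scheme \<Rightarrow> bool" where
  "isoclinic G H \<longleftrightarrow>
    (\<exists>\<phi> \<in> iso (G Mod center G) (H Mod center H).
     \<exists>\<psi> \<in> iso (commutator_subgroup G) (commutator_subgroup H).
       \<forall>g1 \<in> carrier G. \<forall>g2 \<in> carrier G. \<forall>h1 \<in> carrier H. \<forall>h2 \<in> carrier H.
         \<phi> (center G #>\<^bsub>G\<^esub> g1) = center H #>\<^bsub>H\<^esub> h1 \<and>
         \<phi> (center G #>\<^bsub>G\<^esub> g2) = center H #>\<^bsub>H\<^esub> h2 \<longrightarrow>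
         \<psi> (commutator G g1 g2) = commutator H h1 h2)"

(* The tuple (a, b, c, d) stands for the quaternion a + b i + c j + d k. *)
type_synonym int_quaternion = "int \<times> int \<times> int \<times> int"

fun quaternion_mult :: "int_quaternion \<Rightarrow> int_quaternion \<Rightarrow> int_quaternion" where
  "quaternion_mult (a1, b1, c1, d1) (a2, b2, c2, d2) =
    (a1 * a2 - b1 * b2 - c1 * c2 - d1 * d2,
     a1 * b2 + b1 * a2 + c1 * d2 - d1 * c2,
     a1 * c2 - b1 * d2 + c1 * a2 + d1 * b2,
     a1 * d2 + b1 * c2 - c1 * b2 + d1 * a2)"

definition Q8 :: "int_quaternion monoid" where
  "Q8 = \<lparr>carrier = {(1, 0, 0, 0), (-1, 0, 0, 0), (0, 1, 0, 0), (0, -1, 0, 0),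
                    (0, 0, 1, 0), (0, 0, -1, 0), (0, 0, 0, 1), (0, 0, 0, -1)},
         monoid.mult = quaternion_mult, one = (1, 0, 0, 0)\<rparr>"

lemma group_Q8: "group Q8"
proof (rule groupI)
  fix x y z
  assume "x \<in> carrier Q8" "y \<in> carrier Q8" "z \<in> carrier Q8"
  show "x \<otimes>\<^bsub>Q8\<^esub> y \<otimes>\<^bsub>Q8\<^esub> z = x \<otimes>\<^bsub>Q8\<^esub> (y \<otimes>\<^bsub>Q8\<^esub> z)"
    by (cases x; cases y; cases z) (simp add: Q8_def algebra_simps)
next
  fix x y
  assume "x \<in> carrier Q8" "y \<in> carrier Q8"
  then show "x \<otimes>\<^bsub>Q8\<^esub> y \<in> carrier Q8"
    by (simp only: Q8_def partial_object.simps monoid.simps)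
      (elim insertE emptyE; simp)
next
  show "\<one>\<^bsub>Q8\<^esub> \<in> carrier Q8" by (simp add: Q8_def)
next
  fix x
  show "\<one>\<^bsub>Q8\<^esub> \<otimes>\<^bsub>Q8\<^esub> x = x" by (cases x) (simp add: Q8_def)
next
  fix x
  assume "x \<in> carrier Q8"
  then show "\<exists>y\<in>carrier Q8. y \<otimes>\<^bsub>Q8\<^esub> x = \<one>\<^bsub>Q8\<^esub>"
    by (simp add: Q8_def) (elim disjE; simp)
qed

lemma order_Q8: "order Q8 = 8"
  by (simp add: order_def Q8_def)

lemma (in group) center_normal: "center G \<lhd> G"
proof (rule normalI)
  show "subgroup (center G) G"
  proof (rule subgroupI)
    show "center G \<noteq> {}"
      using one_closed l_one r_one unfolding center_def by fastforce
  next
    fix a assume a: "a \<in> center G"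
    then have aG: "a \<in> carrier G" unfolding center_def by blast
    have "inv a \<otimes> g = g \<otimes> inv a" if g: "g \<in> carrier G" for g
    proof -
      have "a \<otimes> inv g = inv g \<otimes> a"
        using a g inv_closed unfolding center_def by blast
      then have "inv (a \<otimes> inv g) = inv (inv g \<otimes> a)" by (rule arg_cong)
      then show ?thesis
        using aG g by (simp add: inv_mult_group)
    qed
    then show "inv a \<in> center G"
      using aG inv_closed unfolding center_def by blast
  next
    fix a b assume a: "a \<in> center G" and b: "b \<in> center G"
    have "a \<otimes> b \<otimes> g = g \<otimes> (a \<otimes> b)" if g: "g \<in> carrier G" for g
    proof -
      have ab: "a \<in> carrier G" "b \<in> carrier G"
        using a b unfolding center_def by blast+
      have "a \<otimes> b \<otimes> g = a \<otimes> (b \<otimes> g)" using ab g by (rule m_assoc)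
      also have "b \<otimes> g = g \<otimes> b" using b g unfolding center_def by blast
      also have "a \<otimes> (g \<otimes> b) = a \<otimes> g \<otimes> b" using ab g by (simp add: m_assoc)
      also have "a \<otimes> g = g \<otimes> a" using a g unfolding center_def by blast
      finally show ?thesis using ab g by (simp add: m_assoc)
    qed
    then show "a \<otimes> b \<in> center G"
      using a b m_closed unfolding center_def by blast
  qed (unfold center_def, blast)
next
  show "\<forall>x\<in>carrier G. center G #> x = x <# center G"
    unfolding r_coset_def l_coset_def center_def by blast
qed

end

theory Submission
  imports Defs
begin

text \<open>
  If the proper centralizers of \<open>G\<close> are \<open>A\<close>, \<open>B\<close>, \<open>C\<close>, then \<open>G = A \<union> B \<union> C\<close>, because every
  non-central element lies in its own centralizer. By Scorza's argument a group that is the union of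
  three proper subgroups satisfies \<open>A \<inter> B = B \<inter> C = A \<inter> C\<close>; here this intersection is the center, so
  non-central elements commute only if they have the same centralizer, and \<open>G\<close> is covered by the
  cosets \<open>Z\<close>, \<open>Z a\<close>, \<open>Z b\<close>, \<open>Z a b\<close> for some non-commuting \<open>a\<close> and \<open>b\<close>. Any two groups with such a
  cover are isoclinic: commuting or not with \<open>b\<close> and with \<open>a\<close> identifies the central quotient with
  the Klein four-group, the derived subgroup is \<open>{1, [a, b]}\<close>, and the commutator is the symplectic
  form on the Klein four-group.
\<close>

section \<open>Unions of three proper subgroups\<close>

lemma (in group) mult_left_mem_subgroup:
  assumes "subgroup H G" "y \<in> H" "x \<in> carrier G" "x \<otimes> y \<in> H"
  shows "x \<in> H"
proof -
  have "y \<in> carrier G" using assms(1,2) by (rule subgroup.mem_carrier)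
  then have "x = (x \<otimes> y) \<otimes> inv y" using assms(3) by (simp add: m_assoc)
  then show ?thesis
    using assms by (metis subgroup.m_closed subgroup.m_inv_closed)
qed

lemma (in group) mult_right_mem_subgroup:
  assumes "subgroup H G" "x \<in> H" "y \<in> carrier G" "x \<otimes> y \<in> H"
  shows "y \<in> H"
proof -
  have "x \<in> carrier G" using assms(1,2) by (rule subgroup.mem_carrier)
  then have "y = inv x \<otimes> (x \<otimes> y)" using assms(3) by (simp add: m_assoc[symmetric])
  then show ?thesis
    using assms by (metis subgroup.m_closed subgroup.m_inv_closed)
qed

text \<open>Take one element outside each subgroup. Each then lies in the other one, and whichever
  subgroup holds their product must by cancellation hold both factors.\<close>

lemma (in group) union_two_proper_subgroups:
  assumes "subgroup A G" "subgroup B G" "A \<noteq> carrier G" "B \<noteq> carrier G"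
  shows "A \<union> B \<noteq> carrier G"
proof
  assume U: "A \<union> B = carrier G"
  obtain x where x: "x \<in> carrier G" "x \<notin> A"
    using assms(1,3) subgroup.subset by blast
  obtain y where y: "y \<in> carrier G" "y \<notin> B"
    using assms(2,4) subgroup.subset by blast
  have xy: "x \<in> B" "y \<in> A" using x y U by auto
  have "x \<otimes> y \<in> A \<union> B" using x y U by auto
  then show False
    using mult_left_mem_subgroup[OF assms(1) xy(2) x(1)]
      mult_right_mem_subgroup[OF assms(2) xy(1) y(1)] x(2) y(2) by blast
qed

text \<open>Scorza's argument: two proper subgroups leave some \<open>y\<close> uncovered, and this
  \<open>y\<close> lies in \<open>C\<close>. For \<open>x\<close> in both \<open>A\<close> and
  \<open>B\<close>, the product of \<open>x\<close> and \<open>y\<close> can lie only in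
  \<open>C\<close>, and cancelling \<open>y\<close> puts \<open>x\<close> there too.\<close>

lemma (in group) union_three_proper_subgroups_Int:
  assumes "subgroup A G" "subgroup B G" "subgroup C G"
    and "A \<noteq> carrier G" "B \<noteq> carrier G"
    and U: "A \<union> B \<union> C = carrier G"
  shows "A \<inter> B \<subseteq> C"
proof
  fix x assume x: "x \<in> A \<inter> B"
  obtain y where y: "y \<in> C" "y \<notin> A" "y \<notin> B"
    using union_two_proper_subgroups[OF assms(1,2,4,5)] U by auto
  have c: "x \<in> carrier G" "y \<in> carrier G" using x y U by auto
  then have "x \<otimes> y \<in> A \<union> B \<union> C" using U by simp
  moreover have "x \<otimes> y \<notin> A" "x \<otimes> y \<notin> B"
    using mult_right_mem_subgroup[OF assms(1) _ c(2)]
      mult_right_mem_subgroup[OF assms(2) _ c(2)] x y by blast+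
  ultimately show "x \<in> C"
    using mult_left_mem_subgroup[OF assms(3) y(1) c(1)] by blast
qed

lemma (in group) union_three_subgroups_mult:
  assumes "subgroup A G" "subgroup B G" "A \<union> B \<union> C = carrier G"
    and "x \<in> A" "x \<notin> B" "y \<in> B" "y \<notin> A"
  shows "x \<otimes> y \<in> C - A - B"
proof -
  have c: "x \<in> carrier G" "y \<in> carrier G" using assms by auto
  have "x \<otimes> y \<notin> A" "x \<otimes> y \<notin> B"
    using mult_right_mem_subgroup[OF assms(1,4) c(2)]
      mult_left_mem_subgroup[OF assms(2,6) c(1)] assms by blast+
  moreover have "x \<otimes> y \<in> A \<union> B \<union> C" using c assms(3) by simp
  ultimately show ?thesis by blast
qed

text \<open>Multiplying \<open>x\<close> and \<open>x'\<close> on the right by the same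
  \<open>y\<close> sends both into \<open>C\<close>, and \<open>y\<close> disappears from the
  quotient. Thus \<open>A - B\<close> lies within a single right coset of
  \<open>A \<inter> C\<close>.\<close>

lemma (in group) union_three_subgroups_coset:
  assumes sub: "subgroup A G" "subgroup B G" "subgroup C G"
    and U: "A \<union> B \<union> C = carrier G"
    and x: "x \<in> A" "x \<notin> B" and x': "x' \<in> A" "x' \<notin> B" and y: "y \<in> B" "y \<notin> A"
  shows "x \<otimes> inv x' \<in> A \<inter> C"
proof -
  have c: "x \<in> carrier G" "x' \<in> carrier G" "y \<in> carrier G" using x x' y unfolding U[symmetric] by blast+
  have "x \<otimes> y \<in> C" "x' \<otimes> y \<in> C"
    using union_three_subgroups_mult[OF sub(1,2) U] x x' y by blast+
  then have "(x \<otimes> y) \<otimes> inv (x' \<otimes> y) \<in> C"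
    using sub(3) by (simp add: subgroup.m_closed subgroup.m_inv_closed)
  also have "(x \<otimes> y) \<otimes> inv (x' \<otimes> y) = x \<otimes> (y \<otimes> inv y) \<otimes> inv x'"
    using c by (simp only: inv_mult_group m_assoc m_closed inv_closed)
  also have "\<dots> = x \<otimes> inv x'" using c by simp
  finally show ?thesis
    using sub(1) x x' by (simp add: subgroup.m_closed subgroup.m_inv_closed)
qed

section \<open>Groups whose central quotient is a Klein four-group\<close>

text \<open>Inequality of truth values is addition modulo 2. Boolean coordinates let
  \<open>cls\<close> record commutation tests directly.\<close>

definition klein_four :: "(bool \<times> bool) monoid" where
  "klein_four = \<lparr>carrier = UNIV,
     monoid.mult = (\<lambda>p q. (fst p \<noteq> fst q, snd p \<noteq> snd q)), one = (False, False)\<rparr>"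

lemma group_klein_four: "group klein_four"
  by (rule groupI) (auto simp: klein_four_def)

lemma (in group) center_carrier: "z \<in> center G \<Longrightarrow> z \<in> carrier G"
  by (simp add: center_def)

lemma (in group) center_comm: "z \<in> center G \<Longrightarrow> x \<in> carrier G \<Longrightarrow> z \<otimes> x = x \<otimes> z"
  by (simp add: center_def)

lemma (in group) center_subgroup: "subgroup (center G) G"
  using center_normal by (rule normal_imp_subgroup)

text \<open>A common interface for the given group and for \<open>Q8\<close>, so that isoclinism is
  proved once, for any two instances.\<close>

locale klein_central_quotient = group G for G (structure) +
  fixes a b
  assumes a_closed [simp]: "a \<in> carrier G" and b_closed [simp]: "b \<in> carrier G"
    and noncomm: "a \<otimes> b \<noteq> b \<otimes> a"
    and cover: "x \<in> carrier G \<Longrightarrow>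
      \<exists>z\<in>center G. x = z \<or> x = z \<otimes> a \<or> x = z \<otimes> b \<or> x = z \<otimes> (a \<otimes> b)"
begin

section \<open>The commutator of \<open>a\<close> and \<open>b\<close> is a central
  involution\<close>

definition t where "t = commutator G a b"

definition sign where "sign i = (if i then t else \<one>)"

text \<open>The test against \<open>b\<close> comes first because it detects the exponent of
  \<open>a\<close>: these are the coordinates of \<open>x\<close> modulo the center in the basis
  \<open>a\<close>, \<open>b\<close>.\<close>

definition cls where "cls x = (x \<otimes> b \<noteq> b \<otimes> x, x \<otimes> a \<noteq> a \<otimes> x)"

lemma comm_central_mult:
  assumes "z \<in> center G" "x \<in> carrier G" "y \<in> carrier G" "x \<otimes> y = y \<otimes> x"
  shows "(z \<otimes> x) \<otimes> y = y \<otimes> (z \<otimes> x)"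
  using assms center_carrier center_comm by (metis m_assoc)

lemma t_closed [simp]: "t \<in> carrier G"
  by (simp add: t_def commutator_def)

lemma t_mult: "t \<otimes> (b \<otimes> a) = a \<otimes> b"
proof -
  have "t = (a \<otimes> b) \<otimes> inv (b \<otimes> a)" by (simp add: t_def commutator_def inv_mult_group m_assoc)
  then have "a \<otimes> b = t \<otimes> (b \<otimes> a)"
    by (rule iffD1[OF inv_solve_right, rotated 3]) simp_all
  then show ?thesis by (rule sym)
qed

lemma t_ne_one: "t \<noteq> \<one>"
  using t_mult noncomm by auto

text \<open>Locate \<open>b \<otimes> a\<close> in the cover. The first three cosets would make
  \<open>a\<close> and \<open>b\<close> commute; in the last one \<open>t\<close> is the inverse of
  the central factor \<open>z\<close>.\<close>

lemma t_center: "t \<in> center G"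
proof -
  obtain z where z: "z \<in> center G"
    and "b \<otimes> a = z \<or> b \<otimes> a = z \<otimes> a \<or> b \<otimes> a = z \<otimes> b \<or> b \<otimes> a = z \<otimes> (a \<otimes> b)"
    using cover[of "b \<otimes> a"] by auto
  then consider "b \<otimes> a = z" | "b \<otimes> a = z \<otimes> a" | "b \<otimes> a = z \<otimes> b" | "b \<otimes> a = z \<otimes> (a \<otimes> b)"
    by blast
  then show ?thesis
  proof cases
    case 1
    then have "b \<otimes> (a \<otimes> b) = b \<otimes> (b \<otimes> a)"
      using center_comm[OF z b_closed] m_assoc[OF b_closed a_closed b_closed] by simp
    then show ?thesis using noncomm by simp
  next
    case 2
    then have "b = z" using center_carrier[OF z] by simp
    then show ?thesis using noncomm center_comm[OF z a_closed] by simp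
  next
    case 3
    then have "b \<otimes> a = b \<otimes> z" using center_comm[OF z b_closed] by simp
    then have "a = z" using center_carrier[OF z] by simp
    then show ?thesis using noncomm center_comm[OF z b_closed] by simp
  next
    case 4
    have "(t \<otimes> z) \<otimes> (a \<otimes> b) = \<one> \<otimes> (a \<otimes> b)"
      using t_mult 4 center_carrier[OF z] by (simp add: m_assoc)
    then have "t \<otimes> z = \<one>"
      using center_carrier[OF z] by (metis a_closed b_closed m_closed one_closed r_cancel t_closed)
    then have "t = inv z" using center_carrier[OF z] by (simp add: inv_equality)
    then show ?thesis using z center_subgroup by (simp add: subgroup.m_inv_closed)
  qed
qed

text \<open>In every other coset of the cover \<open>a\<close> would commute with \<open>b\<close>;
  for the coset of \<open>b\<close> this is because \<open>a\<close> commutes with its own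
  square.\<close>

lemma a_square_center: "a \<otimes> a \<in> center G"
proof -
  obtain z where z: "z \<in> center G"
    and "a \<otimes> a = z \<or> a \<otimes> a = z \<otimes> a \<or> a \<otimes> a = z \<otimes> b \<or> a \<otimes> a = z \<otimes> (a \<otimes> b)"
    using cover[of "a \<otimes> a"] by auto
  then consider "a \<otimes> a = z" | "a \<otimes> a = z \<otimes> a" | "a \<otimes> a = z \<otimes> b" | "a \<otimes> a = z \<otimes> (a \<otimes> b)"
    by blast
  then show ?thesis
  proof cases
    case 1
    then show ?thesis using z by simp
  next
    case 2
    then have "a = z" using center_carrier[OF z] by simp
    then show ?thesis using noncomm center_comm[OF z b_closed] by simp
  next
    case 3
    have "z \<otimes> (a \<otimes> b) = a \<otimes> (z \<otimes> b)"
      using center_carrier[OF z] center_comm[OF z a_closed] by (simp add: m_assoc[symmetric])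
    also have "\<dots> = z \<otimes> b \<otimes> a" by (simp add: 3[symmetric] m_assoc)
    finally have "z \<otimes> (a \<otimes> b) = z \<otimes> (b \<otimes> a)" using center_carrier[OF z] by (simp add: m_assoc)
    then show ?thesis using noncomm center_carrier[OF z] by simp
  next
    case 4
    then have "a \<otimes> a = a \<otimes> (z \<otimes> b)"
      using center_carrier[OF z] center_comm[OF z a_closed] by (simp add: m_assoc[symmetric])
    then have "a = z \<otimes> b" using center_carrier[OF z] by simp
    then show ?thesis
      using noncomm comm_central_mult[OF z b_closed b_closed refl] by simp
  qed
qed

text \<open>Moving \<open>b\<close> past \<open>a\<close> costs a factor \<open>t\<close>. Moving it
  past the central square of \<open>a\<close> costs \<open>t\<close> twice, yet must cost
  nothing.\<close>

lemma t_square: "t \<otimes> t = \<one>"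
proof -
  have "(t \<otimes> t) \<otimes> (b \<otimes> (a \<otimes> a)) = t \<otimes> (t \<otimes> (b \<otimes> a)) \<otimes> a" by (simp add: m_assoc)
  also have "\<dots> = t \<otimes> a \<otimes> b \<otimes> a" by (simp add: t_mult m_assoc)
  also have "t \<otimes> a = a \<otimes> t" by (rule center_comm[OF t_center a_closed])
  also have "a \<otimes> t \<otimes> b \<otimes> a = a \<otimes> a \<otimes> b" by (simp add: m_assoc t_mult)
  also have "\<dots> = b \<otimes> (a \<otimes> a)" by (rule center_comm[OF a_square_center b_closed])
  finally show ?thesis
    by (metis a_closed b_closed l_one m_closed one_closed r_cancel t_closed)
qed

lemma sign_center: "sign i \<in> center G"
  using t_center subgroup.one_closed[OF center_subgroup] by (simp add: sign_def)

lemma sign_closed [simp]: "sign i \<in> carrier G"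
  by (simp add: sign_def)

lemma sign_mult: "sign i \<otimes> sign j = sign (i \<noteq> j)"
  by (simp add: sign_def t_square)

lemma sign_eq_iff: "sign i = sign j \<longleftrightarrow> i = j"
  using t_ne_one by (auto simp: sign_def)

lemma inv_sign: "inv (sign i) = sign i"
  by (rule inv_equality) (simp_all add: sign_mult, simp add: sign_def)

section \<open>Commutation up to a central sign, and the resulting bilinear form\<close>

lemma skew_mult_left:
  assumes "x \<in> carrier G" "y \<in> carrier G" "u \<in> carrier G"
    and "x \<otimes> u = sign i \<otimes> (u \<otimes> x)" "y \<otimes> u = sign j \<otimes> (u \<otimes> y)"
  shows "(x \<otimes> y) \<otimes> u = sign (i \<noteq> j) \<otimes> (u \<otimes> (x \<otimes> y))"
proof -
  \<comment> \<open>The relation between \<open>x\<close> and \<open>u\<close> says that their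
    commutator is \<open>sign i\<close>, without inverses. Signs are central, so both can be
    gathered at the front.\<close>
  have "(x \<otimes> y) \<otimes> u = x \<otimes> sign j \<otimes> u \<otimes> y" using assms by (simp add: m_assoc)
  also have "x \<otimes> sign j = sign j \<otimes> x" using center_comm[OF sign_center assms(1)] by simp
  also have "sign j \<otimes> x \<otimes> u \<otimes> y = sign j \<otimes> sign i \<otimes> (u \<otimes> (x \<otimes> y))"
    using assms by (simp add: m_assoc)
  also have "sign j \<otimes> sign i = sign (i \<noteq> j)" unfolding sign_mult by (rule arg_cong) blast
  finally show ?thesis .
qed

lemma skew_sym:
  assumes "x \<in> carrier G" "y \<in> carrier G" "x \<otimes> y = sign i \<otimes> (y \<otimes> x)"
  shows "y \<otimes> x = sign i \<otimes> (x \<otimes> y)"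
  using assms sign_mult[of i i] by (simp add: m_assoc[symmetric]) (simp add: sign_def)

lemma skew_center:
  assumes "z \<in> center G" "x \<in> carrier G"
  shows "z \<otimes> x = sign False \<otimes> (x \<otimes> z)"
  using assms center_carrier center_comm by (simp add: sign_def)

lemma skew_ab: "a \<otimes> b = sign True \<otimes> (b \<otimes> a)"
  by (simp add: sign_def t_mult)

lemma skew_refl: "x \<in> carrier G \<Longrightarrow> x \<otimes> x = sign False \<otimes> (x \<otimes> x)"
  by (simp add: sign_def)

text \<open>For fixed \<open>u\<close>, sign relations propagate from \<open>a\<close>,
  \<open>b\<close> and the center to all of \<open>G\<close> through products and the cover.\<close>

lemma skew_exists:
  assumes "u \<in> carrier G" "\<exists>i. a \<otimes> u = sign i \<otimes> (u \<otimes> a)" "\<exists>j. b \<otimes> u = sign j \<otimes> (u \<otimes> b)"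
    and "x \<in> carrier G"
  shows "\<exists>k. x \<otimes> u = sign k \<otimes> (u \<otimes> x)"
proof -
  obtain z where z: "z \<in> center G"
    and x: "x = z \<or> x = z \<otimes> a \<or> x = z \<otimes> b \<or> x = z \<otimes> (a \<otimes> b)"
    using cover[OF assms(4)] by auto
  note zu = center_carrier[OF z] skew_center[OF z assms(1)]
  show ?thesis
    using x assms(1-3) zu skew_mult_left a_closed b_closed m_closed by metis
qed

lemma skew_cls:
  assumes "x \<in> carrier G"
  shows "x \<otimes> b = sign (fst (cls x)) \<otimes> (b \<otimes> x)" "x \<otimes> a = sign (snd (cls x)) \<otimes> (a \<otimes> x)"
proof -
  \<comment> \<open>Some sign is known to work. If \<open>x\<close> and \<open>u\<close> do not
    commute it cannot be the identity, so the commutation test determines it.\<close>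
  have *: "x \<otimes> u = sign (x \<otimes> u \<noteq> u \<otimes> x) \<otimes> (u \<otimes> x)"
    if u: "u \<in> carrier G" and k: "\<exists>k. x \<otimes> u = sign k \<otimes> (u \<otimes> x)" for u
  proof (cases "x \<otimes> u = u \<otimes> x")
    case False
    obtain k where k: "x \<otimes> u = sign k \<otimes> (u \<otimes> x)" using k by blast
    then have k using False assms u by (cases k) (auto simp: sign_def)
    then show ?thesis using k False by simp
  qed (use assms u in \<open>simp add: sign_def\<close>)
  show "x \<otimes> b = sign (fst (cls x)) \<otimes> (b \<otimes> x)"
    using *[OF b_closed skew_exists[OF b_closed _ _ assms]] skew_ab skew_refl[OF b_closed]
    unfolding cls_def fst_conv by blast
  show "x \<otimes> a = sign (snd (cls x)) \<otimes> (a \<otimes> x)"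
    using *[OF a_closed skew_exists[OF a_closed _ _ assms]] skew_refl[OF a_closed]
      skew_sym[OF a_closed b_closed skew_ab]
    unfolding cls_def snd_conv by blast
qed

lemma sign_right_cancel:
  "x \<in> carrier G \<Longrightarrow> sign i \<otimes> x = sign j \<otimes> x \<longleftrightarrow> i = j"
  by (simp add: sign_eq_iff)

lemma cls_eqI:
  assumes "x \<in> carrier G"
    and "x \<otimes> b = sign i \<otimes> (b \<otimes> x)" "x \<otimes> a = sign j \<otimes> (a \<otimes> x)"
  shows "cls x = (i, j)"
proof -
  have "sign (fst (cls x)) \<otimes> (b \<otimes> x) = sign i \<otimes> (b \<otimes> x)"
    "sign (snd (cls x)) \<otimes> (a \<otimes> x) = sign j \<otimes> (a \<otimes> x)"
    using skew_cls[OF assms(1)] assms(2,3) by simp_all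
  then have "fst (cls x) = i" "snd (cls x) = j"
    unfolding sign_right_cancel[OF m_closed[OF b_closed assms(1)]]
      sign_right_cancel[OF m_closed[OF a_closed assms(1)]] by simp_all
  then show ?thesis by (simp add: prod_eq_iff)
qed

text \<open>Each coordinate is the sign against a fixed element, so this is
  \<open>skew_mult_left\<close> for \<open>u\<close> equal to \<open>b\<close> and to
  \<open>a\<close>.\<close>

lemma cls_mult:
  assumes "x \<in> carrier G" "y \<in> carrier G"
  shows "cls (x \<otimes> y) = cls x \<otimes>\<^bsub>klein_four\<^esub> cls y"
  unfolding klein_four_def monoid.simps
  using assms by (intro cls_eqI skew_mult_left skew_cls) simp_all

lemma cls_center: "z \<in> center G \<Longrightarrow> cls z = (False, False)"
  by (rule cls_eqI) (simp_all add: center_carrier skew_center)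

lemma cls_a: "cls a = (True, False)"
  by (rule cls_eqI[OF a_closed skew_ab skew_refl[OF a_closed]])

lemma cls_b: "cls b = (False, True)"
  by (rule cls_eqI[OF b_closed skew_refl[OF b_closed] skew_sym[OF a_closed b_closed skew_ab]])

text \<open>The exponent is the determinant, modulo 2, of the coordinate vectors of \<open>x\<close>
  and \<open>y\<close>: the symplectic form on the Klein four-group.\<close>

lemma skew_form:
  assumes x: "x \<in> carrier G" and y: "y \<in> carrier G"
  shows "x \<otimes> y = sign ((fst (cls x) \<and> snd (cls y)) \<noteq> (snd (cls x) \<and> fst (cls y))) \<otimes> (y \<otimes> x)"
proof -
  obtain z where z: "z \<in> center G"
    and y': "y = z \<or> y = z \<otimes> a \<or> y = z \<otimes> b \<or> y = z \<otimes> (a \<otimes> b)"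
    using cover[OF y] by auto
  note c = center_carrier[OF z]
  note zx = skew_center[OF z x]
  note bx = skew_sym[OF x b_closed skew_cls(1)[OF x]]
  note ax = skew_sym[OF x a_closed skew_cls(2)[OF x]]
  have za: "cls (z \<otimes> a) = (True, False)" and zb: "cls (z \<otimes> b) = (False, True)"
    and zab: "cls (z \<otimes> (a \<otimes> b)) = (True, True)"
    using c by (simp_all add: cls_mult cls_center[OF z] cls_a cls_b klein_four_def)
  \<comment> \<open>The factors are swapped because \<open>skew_mult_left\<close> expands the left
    one, and it is \<open>y\<close> that is decomposed by the cover.\<close>
  have "y \<otimes> x = sign ((fst (cls x) \<and> snd (cls y)) \<noteq> (snd (cls x) \<and> fst (cls y))) \<otimes> (x \<otimes> y)"
    using y'
  proof (elim disjE)
    assume "y = z"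
    then show ?thesis using zx cls_center[OF z] by simp
  next
    assume "y = z \<otimes> a"
    then show ?thesis
      using skew_mult_left[OF c a_closed x zx ax] za by simp
  next
    assume "y = z \<otimes> b"
    then show ?thesis
      using skew_mult_left[OF c b_closed x zx bx] zb by simp
  next
    assume "y = z \<otimes> (a \<otimes> b)"
    then show ?thesis
      \<comment> \<open>Here the form is the sum of the two coordinates of \<open>x\<close>; the
        expansion along \<open>a\<close> and then \<open>b\<close> yields the sum in the opposite
        order, whence the commutation of \<open>\<noteq>\<close>.\<close>
      using skew_mult_left[OF c m_closed[OF a_closed b_closed] x zx
          skew_mult_left[OF a_closed b_closed x ax bx]] zab
        arg_cong[OF neq_commute[of "fst (cls x)" "snd (cls x)"], of sign]
      by simp
  qed
  then show ?thesis by (rule skew_sym[OF y x])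
qed

lemma commutator_eq_sign:
  assumes x: "x \<in> carrier G" and y: "y \<in> carrier G"
  shows "commutator G x y =
    sign ((fst (cls x) \<and> snd (cls y)) \<noteq> (snd (cls x) \<and> fst (cls y)))"
proof -
  have "commutator G x y = (x \<otimes> y) \<otimes> inv (y \<otimes> x)"
    using x y by (simp add: commutator_def inv_mult_group m_assoc)
  also have "\<dots> = sign ((fst (cls x) \<and> snd (cls y)) \<noteq> (snd (cls x) \<and> fst (cls y)))"
    by (subst skew_form[OF x y]) (use x y in \<open>simp add: m_assoc\<close>)
  finally show ?thesis .
qed

section \<open>The central quotient and the derived subgroup\<close>

lemma cls_kernel: "kernel G klein_four cls = center G"
proof
  show "center G \<subseteq> kernel G klein_four cls"
    using cls_center center_carrier by (auto simp: kernel_def klein_four_def)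
  show "kernel G klein_four cls \<subseteq> center G"
  proof
    fix x assume "x \<in> kernel G klein_four cls"
    then have x: "x \<in> carrier G" "cls x = (False, False)"
      by (auto simp: kernel_def klein_four_def)
    \<comment> \<open>A zero coordinate vector makes the form vanish against every
      \<open>y\<close>.\<close>
    have "x \<otimes> y = y \<otimes> x" if "y \<in> carrier G" for y
      using skew_form[OF x(1) that] x that by (simp add: sign_def)
    then show "x \<in> center G" using x by (simp add: center_def)
  qed
qed

lemma cls_surj: "cls ` carrier G = carrier klein_four"
proof -
  have "cls \<one> = (False, False)" "cls (a \<otimes> b) = (True, True)"
    using cls_center[OF subgroup.one_closed[OF center_subgroup]]
    by (simp_all add: cls_mult cls_a cls_b klein_four_def)
  then have "(i, j) \<in> cls ` carrier G" for i j
    using cls_a cls_b by (cases i; cases j) (metis a_closed b_closed m_closed one_closed imageI)+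
  then show ?thesis by (auto simp: klein_four_def)
qed

lemma cls_hom: "group_hom G klein_four cls"
proof (intro group_hom.intro group_hom_axioms.intro group_klein_four is_group homI)
  fix x y assume "x \<in> carrier G" "y \<in> carrier G"
  then show "cls (x \<otimes> y) = cls x \<otimes>\<^bsub>klein_four\<^esub> cls y" by (rule cls_mult)
qed (simp add: klein_four_def)

lemma central_quotient_iso:
  "(\<lambda>S. the_elem (cls ` S)) \<in> iso (G Mod center G) klein_four"
  using group_hom.FactGroup_iso_set[OF cls_hom cls_surj] by (simp add: cls_kernel)

text \<open>Central factors have class zero, so \<open>cls\<close> is constant on the coset and its
  image is a singleton.\<close>

lemma the_elem_cls_coset:
  assumes "x \<in> carrier G"
  shows "the_elem (cls ` (center G #> x)) = cls x"
proof -
  have "cls y = cls x" if "y \<in> center G #> x" for y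
    using that assms center_carrier
    by (auto simp: r_coset_def cls_mult cls_center klein_four_def)
  moreover have "x \<in> center G #> x"
    using assms center_subgroup by (simp add: rcos_self)
  ultimately have "cls ` (center G #> x) = {cls x}" by blast
  then show ?thesis by simp
qed

text \<open>Every commutator is a sign, and since \<open>t\<close> is an involution the signs
  already form a subgroup; conversely \<open>t\<close> is itself a commutator.\<close>

lemma derived_eq: "derived G (carrier G) = range sign"
proof
  have "subgroup (range sign) G"
  proof (rule subgroupI)
    fix x y assume "x \<in> range sign" "y \<in> range sign"
    then show "x \<otimes> y \<in> range sign" by (auto simp: sign_mult)
  qed (auto simp: inv_sign)
  moreover have "derived_set G (carrier G) \<subseteq> range sign"
    using commutator_eq_sign by (auto simp: commutator_def)
  ultimately show "derived G (carrier G) \<subseteq> range sign"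
    unfolding derived_def by (rule generate_subgroup_incl[rotated])
  have "t \<in> derived G (carrier G)"
    unfolding derived_def t_def commutator_def
    by (rule generate.incl) (use a_closed b_closed in blast)
  moreover have "\<one> \<in> derived G (carrier G)"
    unfolding derived_def by (rule generate.one)
  ultimately show "range sign \<subseteq> derived G (carrier G)"
    by (auto simp: sign_def)
qed

end

text \<open>Both central quotients are identified with the same \<open>klein_four\<close>, and in
  both groups the commutator is the same boolean form, read through the respective
  \<open>sign\<close>.\<close>

lemma klein_central_quotient_isoclinic:
  fixes G :: "('a, 'c) monoid_scheme" and H :: "('b, 'd) monoid_scheme"
  assumes "klein_central_quotient G a b" "klein_central_quotient H c d"
  shows "isoclinic G H"
proof -
  interpret G: klein_central_quotient G a b by (fact assms(1))
  interpret H: klein_central_quotient H c d by (fact assms(2))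
  define \<theta> where "\<theta> = (\<lambda>S. the_elem (H.cls ` S))"
  define \<phi> where "\<phi> = inv_into (carrier (H Mod center H)) \<theta> \<circ> (\<lambda>S. the_elem (G.cls ` S))"
  \<comment> \<open>As \<open>t\<close> differs from the identity, testing against the identity
    recovers \<open>i\<close> from \<open>G.sign i\<close>.\<close>
  define \<psi> where "\<psi> x = H.sign (x \<noteq> \<one>\<^bsub>G\<^esub>)" for x
  have \<theta>: "\<theta> \<in> iso (H Mod center H) klein_four"
    unfolding \<theta>_def by (rule H.central_quotient_iso)
  have "group (H Mod center H)"
    using H.center_normal by (rule normal.factorgroup_is_group)
  then have "\<phi> \<in> iso (G Mod center G) (H Mod center H)"
    unfolding \<phi>_def
    using iso_set_trans[OF G.central_quotient_iso group.iso_set_sym[OF _ \<theta>]] by (simp add: comp_def)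
  moreover have \<psi>_sign: "\<psi> (G.sign i) = H.sign i" for i
    using G.sign_eq_iff[of i False] by (simp add: \<psi>_def G.sign_def)
  have "\<psi> \<in> iso (commutator_subgroup G) (commutator_subgroup H)"
  proof (rule isoI)
    show "\<psi> \<in> hom (commutator_subgroup G) (commutator_subgroup H)"
      by (rule homI)
        (auto simp: commutator_subgroup_def G.derived_eq H.derived_eq \<psi>_sign
          G.sign_mult H.sign_mult)
    show "bij_betw \<psi> (carrier (commutator_subgroup G)) (carrier (commutator_subgroup H))"
      by (auto simp: bij_betw_def inj_on_def commutator_subgroup_def G.derived_eq H.derived_eq
          \<psi>_sign H.sign_eq_iff image_image)
  qed
  moreover have "\<psi> (commutator G g1 g2) = commutator H h1 h2"
    if g: "g1 \<in> carrier G" "g2 \<in> carrier G" and h: "h1 \<in> carrier H" "h2 \<in> carrier H"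
      and e: "\<phi> (center G #>\<^bsub>G\<^esub> g1) = center H #>\<^bsub>H\<^esub> h1"
        "\<phi> (center G #>\<^bsub>G\<^esub> g2) = center H #>\<^bsub>H\<^esub> h2" for g1 g2 h1 h2
  proof -
    \<comment> \<open>Applying \<theta> to both sides undoes the inverse inside \<phi>, so matching
      cosets have equal coordinates.\<close>
    have cls: "H.cls y = G.cls x"
      if "x \<in> carrier G" "y \<in> carrier H" "\<phi> (center G #>\<^bsub>G\<^esub> x) = center H #>\<^bsub>H\<^esub> y" for x y
    proof -
      have "\<theta> ` carrier (H Mod center H) = UNIV"
        using \<theta> by (simp add: iso_def bij_betw_def klein_four_def)
      then have "\<theta> (inv_into (carrier (H Mod center H)) \<theta> p) = p" for p
        by (simp add: f_inv_into_f)
      then have "\<theta> (\<phi> (center G #>\<^bsub>G\<^esub> x)) = G.cls x"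
        by (simp add: \<phi>_def G.the_elem_cls_coset[OF that(1)])
      then show ?thesis
        by (simp add: that(3) \<theta>_def H.the_elem_cls_coset[OF that(2)])
    qed
    show ?thesis
      by (simp add: G.commutator_eq_sign[OF g] H.commutator_eq_sign[OF h] \<psi>_sign
          cls[OF g(1) h(1) e(1)] cls[OF g(2) h(2) e(2)])
  qed
  ultimately show ?thesis
    unfolding isoclinic_def by blast
qed

text \<open>The generators are the quaternions i and j, with product k; the central factor in the
  cover is 1 or -1.\<close>

lemma klein_central_quotient_Q8: "klein_central_quotient Q8 (0, 1, 0, 0) (0, 0, 1, 0)"
proof (intro klein_central_quotient.intro klein_central_quotient_axioms.intro group_Q8)
  fix x assume x: "x \<in> carrier Q8"
  let ?P = "\<lambda>z. x = z \<or> x = z \<otimes>\<^bsub>Q8\<^esub> (0, 1, 0, 0) \<or> x = z \<otimes>\<^bsub>Q8\<^esub> (0, 0, 1, 0)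
      \<or> x = z \<otimes>\<^bsub>Q8\<^esub> ((0, 1, 0, 0) \<otimes>\<^bsub>Q8\<^esub> (0, 0, 1, 0))"
  have "(1, 0, 0, 0) \<in> center Q8" "(-1, 0, 0, 0) \<in> center Q8"
    by (auto simp: center_def Q8_def)
  moreover have "?P (1, 0, 0, 0) \<or> ?P (-1, 0, 0, 0)"
    using x unfolding Q8_def partial_object.simps monoid.simps
    by (elim insertE emptyE) simp_all
  ultimately show "\<exists>z\<in>center Q8. ?P z" by blast
qed (simp_all add: Q8_def)

section \<open>Groups with four centralizers\<close>

lemma (in group) centralizer_subgroup:
  assumes x: "x \<in> carrier G"
  shows "subgroup (centralizer G x) G"
proof (rule subgroupI)
  show "centralizer G x \<noteq> {}" using x by (auto simp: centralizer_def)
next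
  fix g assume "g \<in> centralizer G x"
  then have g: "g \<in> carrier G" "g \<otimes> x = x \<otimes> g" by (auto simp: centralizer_def)
  have "inv g \<otimes> x = inv g \<otimes> (x \<otimes> g) \<otimes> inv g" using g(1) x by (simp add: m_assoc)
  also have "\<dots> = (inv g \<otimes> g) \<otimes> x \<otimes> inv g"
    using g(1) x unfolding g(2)[symmetric] by (simp only: m_assoc m_closed inv_closed)
  finally have "inv g \<otimes> x = x \<otimes> inv g" using g(1) x by simp
  then show "inv g \<in> centralizer G x" using g by (simp add: centralizer_def)
next
  fix g h assume "g \<in> centralizer G x" "h \<in> centralizer G x"
  then have "g \<in> carrier G" "h \<in> carrier G" "g \<otimes> x = x \<otimes> g" "h \<otimes> x = x \<otimes> h"
    by (auto simp: centralizer_def)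
  then show "g \<otimes> h \<in> centralizer G x"
    using x unfolding centralizer_def by simp (metis m_assoc)
qed (simp add: centralizer_def)

lemma (in group) centralizer_eq_carrier_iff:
  "x \<in> carrier G \<Longrightarrow> centralizer G x = carrier G \<longleftrightarrow> x \<in> center G"
  unfolding centralizer_def center_def set_eq_iff by force

lemma (in group) Inter_Cent: "\<Inter> (Cent G) = center G"
proof
  show "\<Inter> (Cent G) \<subseteq> center G"
  proof
    fix x assume "x \<in> \<Inter> (Cent G)"
    then have "x \<in> centralizer G g" if "g \<in> carrier G" for g
      using that by (auto simp: Cent_def)
    then show "x \<in> center G" by (auto simp: centralizer_def center_def)
  qed
qed (auto simp: Cent_def centralizer_def center_def)

lemma (in group) four_centralizer_klein_central_quotient:
  assumes "n_centralizer 4 G"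
  shows "\<exists>a b. klein_central_quotient G a b"
proof -
  have GC: "carrier G \<in> Cent G"
  proof -
    have "centralizer G \<one> = carrier G" by (auto simp: centralizer_def)
    then show ?thesis unfolding Cent_def by (metis imageI one_closed)
  qed
  have "card (Cent G - {carrier G}) = 3"
    using assms GC by (simp add: n_centralizer_def)
  then obtain A B C where ABC: "Cent G - {carrier G} = {A, B, C}"
    and ne: "A \<noteq> B" "A \<noteq> C" "B \<noteq> C"
    by (auto simp: card_3_iff)
  have Cent: "Cent G = {carrier G, A, B, C}" using ABC GC by blast
  have "subgroup S G" if "S \<in> Cent G" for S
    using that centralizer_subgroup by (auto simp: Cent_def)
  then have sub: "subgroup A G" "subgroup B G" "subgroup C G" using Cent by auto
  have proper: "A \<noteq> carrier G" "B \<noteq> carrier G" "C \<noteq> carrier G" using ABC by auto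
  have Z: "A \<inter> B \<inter> C = center G"
    using Inter_Cent sub[THEN subgroup.subset] unfolding Cent by auto
  have own: "centralizer G x \<in> {A, B, C} \<and> x \<in> centralizer G x"
    if "x \<in> carrier G" "x \<notin> center G" for x
  proof -
    have "centralizer G x \<in> Cent G - {carrier G}"
      using that centralizer_eq_carrier_iff by (simp add: Cent_def)
    then show ?thesis using that(1) unfolding ABC by (simp add: centralizer_def)
  qed
  \<comment> \<open>A non-central element lies in its own centralizer, which is proper; central
    elements lie in all three.\<close>
  have U: "A \<union> B \<union> C = carrier G"
    using own Z sub[THEN subgroup.subset] by blast
  have AB: "A \<inter> B = center G"
    using union_three_proper_subgroups_Int[OF sub(1,2,3) proper(1,2) U] Z by blast
  have AC: "A \<inter> C = center G"
    using union_three_proper_subgroups_Int[OF sub(1,3,2) proper(1,3)] U Z by blast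
  have BC: "B \<inter> C = center G"
    using union_three_proper_subgroups_Int[OF sub(2,3,1) proper(2,3)] U Z by blast
  obtain a where a: "a \<in> A" "a \<notin> B" "a \<notin> C" "a \<in> carrier G"
    using union_two_proper_subgroups[OF sub(2,3) proper(2,3)] U by auto
  obtain b where b: "b \<in> B" "b \<notin> A" "b \<notin> C" "b \<in> carrier G"
    using union_two_proper_subgroups[OF sub(1,3) proper(1,3)] U by auto
  have ab: "a \<otimes> b \<in> C" "a \<otimes> b \<notin> A" "a \<otimes> b \<notin> B"
    using union_three_subgroups_mult[OF sub(1,2) U a(1,2) b(1,2)] by auto
  \<comment> \<open>The element \<open>a\<close> belongs to its own centralizer, and
    \<open>A\<close> is the only one of the three that contains \<open>a\<close>.\<close>
  have "centralizer G a = A" using own[OF a(4)] a Z by blast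
  then have noncomm: "a \<otimes> b \<noteq> b \<otimes> a"
    using b by (auto simp: centralizer_def)
  have coset: "\<exists>z\<in>center G. x = z \<otimes> y"
    if "x \<otimes> inv y \<in> center G" "x \<in> carrier G" "y \<in> carrier G" for x y
    using that by (intro bexI[of _ "x \<otimes> inv y"]) (simp_all add: m_assoc)
  have "\<exists>z\<in>center G. x = z \<or> x = z \<otimes> a \<or> x = z \<otimes> b \<or> x = z \<otimes> (a \<otimes> b)"
    if x: "x \<in> carrier G" for x
  proof -
    \<comment> \<open>An element of both \<open>C\<close> and \<open>A\<close> falls under the
      second case, or is central when it also lies in \<open>B\<close>.\<close>
    consider "x \<in> center G" | "x \<in> A" "x \<notin> B" | "x \<in> B" "x \<notin> A" | "x \<in> C" "x \<notin> A"
      using x U AB by blast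
    then show ?thesis
    proof cases
      case 2
      \<comment> \<open>Each coset is compared with its representative \<open>a\<close>,
        \<open>b\<close> or their product. The auxiliary right factor is \<open>b\<close> here and
        \<open>a\<close> in the other two cases.\<close>
      then have "x \<otimes> inv a \<in> A \<inter> C"
        using union_three_subgroups_coset[OF sub U] a b by blast
      then show ?thesis using coset[OF _ x a(4)] AC by blast
    next
      case 3
      have "B \<union> A \<union> C = carrier G" using U by blast
      then have "x \<otimes> inv b \<in> B \<inter> C"
        using union_three_subgroups_coset[OF sub(2,1,3)] 3 a b by blast
      then show ?thesis using coset[OF _ x b(4)] BC by blast
    next
      case 4
      have "C \<union> A \<union> B = carrier G" using U by blast
      then have "x \<otimes> inv (a \<otimes> b) \<in> C \<inter> B"
        using union_three_subgroups_coset[OF sub(3,1,2)] 4 ab a by blast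
      then show ?thesis using coset[OF _ x m_closed[OF a(4) b(4)]] BC by blast
    qed blast
  qed
  then have "klein_central_quotient G a b"
    using a b noncomm
    by (intro klein_central_quotient.intro klein_central_quotient_axioms.intro is_group) auto
  then show ?thesis by blast
qed

theorem proposition3p15:
  fixes G :: "('a, 'b) monoid_scheme"
  assumes "group G"
    and "n_centralizer 4 G"
  shows "isoclinic G Q8"
proof -
  obtain a b where "klein_central_quotient G a b"
    using group.four_centralizer_klein_central_quotient[OF assms] by blast
  then show ?thesis
    using klein_central_quotient_Q8 by (rule klein_central_quotient_isoclinic)
qed

end
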